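(* Let $A,B>0$, $k\in\mathbb R\setminus\{0\}$, let $\chi_0\in\mathbb R\setminus\{0,k,-k\}$ satisfy $\Lambda'(\chi_0)=0$, $\Lambda''(\chi_0)\ne0$, let $r\in\mathbb C\setminus\{0\}$ satisfy $b_J|r|^2+2a_J\operatorname{Re}r=0$, and let $\alpha\in\mathbb R$ with $\sin\alpha\ne0$ (notation in context). Assume $\gamma_t\ne0$. For $\rho\in\mathbb R$ let $$\mathcal C_\rho^{(\alpha,r)}=\{(x,t)\in\mathbb R^2:\operatorname{Im}\mathcal D_\alpha^{(r)}(x,t)=\rho\}.$$ Then, for every $\rho\in\mathbb R$, $$\lim_{\substack{|\xi|\to\infty\\(x,t)\in\mathcal C_\rho^{(\alpha,r)}}}\frac{u_j^{(R,2;\alpha,r)}(x,t)}{u_{j,0}(x,t)}=1-2h_j(\chi_0),\qquad j=1,2 .$$ Thus the modulation does not approach the plane-wave background along these unbounded curves.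
   Context: $S=A+B$, $R=A-B$; $a_1,a_2\in\mathbb R$ with $a_1^2=A$, $a_2^2=B$; $k_1=k$, $k_2=-k$; $\omega_1=1/k-A$, $\omega_2=-1/k-B$; $u_{j,0}=a_j\exp[\mathrm i(k_jx+\omega_jt)]$. $\Lambda(\chi)=\frac1\chi\big[2-k^2\big(\frac{A}{\chi+k}+\frac{B}{\chi-k}\big)\big]$. $h_1(\chi)=\frac{k}{k+\chi}$, $h_2(\chi)=\frac{k}{k-\chi}$, $h_{j,n}=h_j^{(n)}(\chi_0)$. $\mu_0=\Lambda(\chi_0)$ (automatically $>0$), $\lambda_0=\sqrt{\mu_0}>0$, $\chi_s=\frac2{\mu_0}-2\chi_0$, $L_0=\chi_0-\chi_s\neq0$, $D_0=\chi_0^3-k^2\chi_0$, $D_1=3\chi_0^2-k^2$, $p_1=\frac{D_0}{\mu_0L_0}$, $s_1=\frac{p_1-D_1/\mu_0}{L_0}$. $\nu_1=-\frac{2-kR}{2\chi_0^2}$, $\nu_2=\frac{2-kR}{\chi_0^3}$, $\nu_3=-\frac{3(2-kR)}{\chi_0^4}$, $\xi=x+\nu_1t$. Real constants: $a_J=-Ah_{1,0}h_{1,1}-Bh_{2,0}h_{2,1}$, $b_J=-Ah_{1,1}^2-Bh_{2,1}^2$, $c_J=-Ah_{1,0}h_{1,2}-Bh_{2,0}h_{2,2}$, $d_J=-Ah_{1,0}h_{1,3}-Bh_{2,0}h_{2,3}$, $e_J=-Ah_{1,1}h_{1,2}-Bh_{2,1}h_{2,2}$, $f_J=-Ah_{1,1}h_{1,3}-Bh_{2,1}h_{2,3}$.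 With $u=\operatorname{Re}r$, $v=\operatorname{Im}r$, $\varrho=|r|^2$: $\gamma_3=-\frac{\chi_0}{3}\varrho$; $\gamma_2=\chi_0v$; $\gamma_1=-\chi_0+a_Js_1u-b_Jp_1u+b_Js_1\varrho-\frac{c_Js_1}{2}\varrho+\frac{d_Jp_1}{6}\varrho-\frac{e_Jp_1}{2}\varrho$; $\gamma_t=\frac{a_J\varrho}{6}(3\nu_2s_1-\nu_3p_1)$; $\gamma_0=v\big(\frac{c_Js_1}{2}-\frac{d_Jp_1}{6}+\frac{e_Jp_1}{2}\big)$; $\zeta_0=\frac12-\frac{c_Jp_1}{2}+\frac{c_Js_1u}{2}-\frac{d_Jp_1u}{6}-\frac{e_Jp_1u}{2}+\frac{e_Js_1}{2}\varrho-\frac{f_Jp_1}{6}\varrho$. Define $$\mathcal D_\alpha^{(r)}(x,t)=-\lambda_0|1+\mathrm ir\xi|^2+2\mathrm i\lambda_0\big[\zeta_0\cot\alpha-\gamma_3\xi^3-\gamma_2\xi^2-\gamma_1\xi-\gamma_tt-\gamma_0\big],$$ $$\mathcal N_j^{(r)}(x,t)=2\lambda_0\big(h_{j,0}+rh_{j,1}+\mathrm irh_{j,0}\xi\big)(1+\mathrm ir\xi)^*,\qquad u_j^{(R,2;\alpha,r)}=u_{j,0}\Big[1+\frac{\mathcal N_j^{(r)}}{\mathcal D_\alpha^{(r)}}\Big],\quad j=1,2.$$ $\mathcal D_\alpha^{(r)}$ has no real zeros. *)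

theory Defs
  imports "HOL-Analysis.Analysis"
begin

context
  fixes A B k :: real
begin

definition Lam :: "real \<Rightarrow> real" where
  "Lam chi = (1 / chi) * (2 - k\<^sup>2 * (A / (chi + k) + B / (chi - k)))"

text \<open>The index \<open>j\<close> of the two field components ranges over \<open>1, 2\<close>; any value other than
  \<open>1\<close> is treated as \<open>2\<close>.\<close>

definition h :: "nat \<Rightarrow> real \<Rightarrow> real" where
  "h j chi = (if j = 1 then k / (k + chi) else k / (k - chi))"

definition wavenum :: "nat \<Rightarrow> real" where
  "wavenum j = (if j = 1 then k else - k)"

definition omega :: "nat \<Rightarrow> real" where
  "omega j = (if j = 1 then 1 / k - A else - (1 / k) - B)"

definition u0 :: "(nat \<Rightarrow> real) \<Rightarrow> nat \<Rightarrow> real \<Rightarrow> real \<Rightarrow> complex" where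
  "u0 a j x t = of_real (a j) * exp (\<i> * of_real (wavenum j * x + omega j * t))"

end

context
  fixes A B k chi0 :: real
begin

definition hder :: "nat \<Rightarrow> nat \<Rightarrow> real" where
  "hder j n = (deriv ^^ n) (h k j) chi0"

definition mu0 :: real where
  "mu0 = Lam A B k chi0"

definition lambda0 :: real where
  "lambda0 = sqrt mu0"

definition chi_s :: real where
  "chi_s = 2 / mu0 - 2 * chi0"

text \<open>Suppose \<open>chi0 \<notin> {0, k, -k}\<close> is a critical point of \<open>Lam\<close> with nonvanishing second derivative,
  and \<open>A, B > 0\<close>, \<open>k \<noteq> 0\<close>. Differentiating \<open>chi * Lam chi\<close> at \<open>chi0\<close> gives
  \<open>mu0 = k\<^sup>2 * (A / (chi0 + k)\<^sup>2 + B / (chi0 - k)\<^sup>2) > 0\<close>; and \<open>Lam chi = mu0\<close> is a cubic equation with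
  double root \<open>chi0\<close> and remaining root \<open>chi_s \<noteq> chi0\<close>, so \<open>L0 \<noteq> 0\<close>.\<close>

definition L0 :: real where
  "L0 = chi0 - chi_s"

definition D0 :: real where
  "D0 = chi0 ^ 3 - k\<^sup>2 * chi0"

definition D1 :: real where
  "D1 = 3 * chi0\<^sup>2 - k\<^sup>2"

definition p1 :: real where
  "p1 = D0 / (mu0 * L0)"

definition s1 :: real where
  "s1 = (p1 - D1 / mu0) / L0"

definition nu1 :: real where
  "nu1 = - (2 - k * (A - B)) / (2 * chi0\<^sup>2)"

definition nu2 :: real where
  "nu2 = (2 - k * (A - B)) / chi0 ^ 3"

definition nu3 :: real where
  "nu3 = - (3 * (2 - k * (A - B))) / chi0 ^ 4"

definition xi :: "real \<Rightarrow> real \<Rightarrow> real" where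
  "xi x t = x + nu1 * t"

definition aJ :: real where
  "aJ = - A * hder 1 0 * hder 1 1 - B * hder 2 0 * hder 2 1"

definition bJ :: real where
  "bJ = - A * (hder 1 1)\<^sup>2 - B * (hder 2 1)\<^sup>2"

definition cJ :: real where
  "cJ = - A * hder 1 0 * hder 1 2 - B * hder 2 0 * hder 2 2"

definition dJ :: real where
  "dJ = - A * hder 1 0 * hder 1 3 - B * hder 2 0 * hder 2 3"

definition eJ :: real where
  "eJ = - A * hder 1 1 * hder 1 2 - B * hder 2 1 * hder 2 2"

definition fJ :: real where
  "fJ = - A * hder 1 1 * hder 1 3 - B * hder 2 1 * hder 2 3"

context
  fixes r :: complex
begin

definition gamma3 :: real where
  "gamma3 = - (chi0 / 3) * (cmod r)\<^sup>2"

definition gamma2 :: real where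
  "gamma2 = chi0 * Im r"

definition gamma1 :: real where
  "gamma1 = - chi0 + aJ * s1 * Re r - bJ * p1 * Re r + bJ * s1 * (cmod r)\<^sup>2
     - (cJ * s1 / 2) * (cmod r)\<^sup>2 + (dJ * p1 / 6) * (cmod r)\<^sup>2 - (eJ * p1 / 2) * (cmod r)\<^sup>2"

definition gamma_t :: real where
  "gamma_t = (aJ * (cmod r)\<^sup>2 / 6) * (3 * nu2 * s1 - nu3 * p1)"

definition gamma0 :: real where
  "gamma0 = Im r * (cJ * s1 / 2 - dJ * p1 / 6 + eJ * p1 / 2)"

definition zeta0 :: real where
  "zeta0 = 1 / 2 - cJ * p1 / 2 + cJ * s1 * Re r / 2 - dJ * p1 * Re r / 6 - eJ * p1 * Re r / 2
     + (eJ * s1 / 2) * (cmod r)\<^sup>2 - (fJ * p1 / 6) * (cmod r)\<^sup>2"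

definition Dden :: "real \<Rightarrow> real \<Rightarrow> real \<Rightarrow> complex" where
  "Dden \<alpha> x t =
     - of_real (lambda0 * (cmod (1 + \<i> * r * of_real (xi x t)))\<^sup>2)
     + 2 * \<i> * of_real lambda0 *
       of_real (zeta0 * cot \<alpha> - gamma3 * xi x t ^ 3 - gamma2 * (xi x t)\<^sup>2
                - gamma1 * xi x t - gamma_t * t - gamma0)"

definition Nnum :: "nat \<Rightarrow> real \<Rightarrow> real \<Rightarrow> complex" where
  "Nnum j x t =
     2 * of_real lambda0 *
     (of_real (hder j 0) + r * of_real (hder j 1) + \<i> * r * of_real (hder j 0) * of_real (xi x t)) *
     cnj (1 + \<i> * r * of_real (xi x t))"

definition uR2 :: "(nat \<Rightarrow> real) \<Rightarrow> real \<Rightarrow> nat \<Rightarrow> real \<Rightarrow> real \<Rightarrow> complex" where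
  "uR2 a \<alpha> j x t = u0 A B k a j x t * (1 + Nnum j x t / Dden \<alpha> x t)"

definition Crho :: "real \<Rightarrow> real \<Rightarrow> (real \<times> real) set" where
  "Crho \<alpha> \<rho> = {(x, t). Im (Dden \<alpha> x t) = \<rho>}"

definition along_Crho :: "real \<Rightarrow> real \<Rightarrow> (real \<times> real) filter" where
  "along_Crho \<alpha> \<rho> =
     inf (filtercomap (\<lambda>(x, t). \<bar>xi x t\<bar>) at_top) (principal (Crho \<alpha> \<rho>))"

end

end

end

theory Submission
  imports Defs
begin

text \<open>Write \<open>z = 1 + i r \<xi>\<close>. On a curve \<open>Im D = \<rho>\<close> the denominator is \<open>- \<lambda>\<^sub>0 |z|\<^sup>2 + i \<rho>\<close>, while the
  numerator is \<open>2 \<lambda>\<^sub>0 (h\<^sub>j |z|\<^sup>2 + r h\<^sub>j' z\<^sup>*)\<close>, so after division by \<open>|z|\<^sup>2\<close> the quotient tends to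
  \<open>- 2 h\<^sub>j\<close> as \<open>|\<xi>| \<rightarrow> \<infinity>\<close>. Since \<open>\<gamma>\<^sub>t \<noteq> 0\<close>, every value of \<open>\<xi>\<close> is attained on the curve, so the limit
  is not vacuous.\<close>

text \<open>The product rule leaves the term \<open>- (2 - k\<^sup>2 * P) / chi\<^sup>2\<close>,
  which is \<open>- Lam A B k chi / chi\<close>. Keeping \<open>Lam\<close> in the formula lets a
  critical point determine the value of \<open>Lam\<close> there.\<close>

lemma Lam_has_real_derivative:
  fixes A B k chi :: real
  assumes "chi \<notin> {0, k, - k}"
  shows "(Lam A B k has_real_derivative
    (k\<^sup>2 * (A / (chi + k)\<^sup>2 + B / (chi - k)\<^sup>2) - Lam A B k chi) / chi) (at chi)"
proof -
  have nz: "chi \<noteq> 0" "chi + k \<noteq> 0" "chi - k \<noteq> 0"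
    using assms by auto
  define P where "P = A / (chi + k) + B / (chi - k)"
  define Q where "Q = A / (chi + k)\<^sup>2 + B / (chi - k)\<^sup>2"
  have "((\<lambda>c. A / (c + k) + B / (c - k)) has_real_derivative - Q) (at chi)"
    unfolding Q_def using nz
    by (auto intro!: derivative_eq_intros simp: power2_eq_square)
  from DERIV_mult[OF DERIV_inverse[OF nz(1)] DERIV_diff[OF DERIV_const DERIV_cmult[OF this]], of 2 "k\<^sup>2"]
  have "(Lam A B k has_real_derivative
      - (inverse chi)\<^sup>2 * (2 - k\<^sup>2 * P) + (k\<^sup>2 * Q) * inverse chi) (at chi)"
    unfolding Lam_def[abs_def] P_def by (simp add: inverse_eq_divide power2_eq_square)
  moreover have "- (inverse chi)\<^sup>2 * (2 - k\<^sup>2 * P) + (k\<^sup>2 * Q) * inverse chi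
      = (k\<^sup>2 * Q - Lam A B k chi) / chi"
    using nz(1) unfolding Lam_def P_def by (simp add: field_simps power2_eq_square)
  ultimately show ?thesis
    by (simp add: Q_def)
qed

text \<open>At a critical point the numerator of the derivative vanishes, so \<open>mu0\<close>
  equals \<open>k\<^sup>2\<close> times a sum of two positive fractions. This is what makes
  \<open>lambda0\<close> nonzero.\<close>

lemma mu0_pos:
  fixes A B k chi0 :: real
  assumes "A > 0" "B > 0" "k \<noteq> 0" and chi0: "chi0 \<notin> {0, k, - k}"
    and crit: "deriv (Lam A B k) chi0 = 0"
  shows "mu0 A B k chi0 > 0"
proof -
  have "(k\<^sup>2 * (A / (chi0 + k)\<^sup>2 + B / (chi0 - k)\<^sup>2) - Lam A B k chi0) / chi0 = 0"
    using DERIV_imp_deriv[OF Lam_has_real_derivative[OF chi0]] crit by metis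
  then have "mu0 A B k chi0 = k\<^sup>2 * (A / (chi0 + k)\<^sup>2 + B / (chi0 - k)\<^sup>2)"
    using chi0 by (simp add: mu0_def)
  moreover have "chi0 + k \<noteq> 0" "chi0 - k \<noteq> 0"
    using chi0 by auto
  ultimately show ?thesis
    using assms(1-3) by (simp add: add_pos_pos)
qed

text \<open>Dividing numerator and denominator by \<open>z * cnj z\<close> turns every lower-order
  term into a multiple of \<open>inverse z\<close>, which tends to 0. The denominator then tends to
  \<open>- l\<close>, nonzero by assumption.\<close>

lemma tendsto_quotient_at_infinity:
  fixes z :: "'b \<Rightarrow> complex" and l \<rho> b c :: complex
  assumes z: "filterlim z at_infinity F" and l: "l \<noteq> 0"
  shows "((\<lambda>p. 2 * l * (b * z p + c) * cnj (z p) / (- (l * (z p * cnj (z p))) + \<rho>)) \<longlongrightarrow> - 2 * b) F"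
proof -
  have inv: "((\<lambda>p. inverse (z p)) \<longlongrightarrow> 0) F"
    using filterlim_compose[OF tendsto_inverse_0 z] .
  have "((\<lambda>p. 2 * l * (b + c * inverse (z p)) / (- l + \<rho> * (inverse (z p) * cnj (inverse (z p)))))
      \<longlongrightarrow> 2 * l * (b + c * 0) / (- l + \<rho> * (0 * cnj 0))) F"
    using l by (intro tendsto_intros inv) auto
  then have lim: "((\<lambda>p. 2 * l * (b + c * inverse (z p)) / (- l + \<rho> * (inverse (z p) * cnj (inverse (z p)))))
      \<longlongrightarrow> - 2 * b) F"
    using l by (simp add: field_simps)
  have "eventually (\<lambda>p. z p \<noteq> 0) F"
    using z by (rule filterlim_at_infinity_imp_eventually_ne)
  then have "eventually (\<lambda>p. 2 * l * (b + c * inverse (z p)) / (- l + \<rho> * (inverse (z p) * cnj (inverse (z p))))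
      = 2 * l * (b * z p + c) * cnj (z p) / (- (l * (z p * cnj (z p))) + \<rho>)) F"
  proof eventually_elim
    case (elim p)
    \<comment> \<open>Cancelling the nonzero factor \<open>w\<close> is sound even where the
      denominator is 0, since both quotients are then 0 by convention.\<close>
    define w where "w = z p * cnj (z p)"
    have w: "w \<noteq> 0"
      using elim by (simp add: w_def)
    have "2 * l * (b + c * inverse (z p)) / (- l + \<rho> * (inverse (z p) * cnj (inverse (z p))))
        = (2 * l * (b + c * inverse (z p)) * w)
          / ((- l + \<rho> * (inverse (z p) * cnj (inverse (z p)))) * w)"
      using w by simp
    also have "2 * l * (b + c * inverse (z p)) * w = 2 * l * (b * z p + c) * cnj (z p)"
      using elim by (simp add: w_def field_simps)
    also have "(- l + \<rho> * (inverse (z p) * cnj (inverse (z p)))) * w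
        = - (l * (z p * cnj (z p))) + \<rho>"
      using elim by (simp add: w_def field_simps)
    finally show ?case .
  qed
  with lim show ?thesis
    using tendsto_cong by force
qed

lemma hder_0: "hder k chi0 j 0 = h k j chi0"
  by (simp add: hder_def)

lemma Im_Dden:
  "Im (Dden A B k chi0 r \<alpha> x t) = 2 * lambda0 A B k chi0 *
     (zeta0 A B k chi0 r * cot \<alpha> - gamma3 chi0 r * xi A B k chi0 x t ^ 3
      - gamma2 chi0 r * (xi A B k chi0 x t)\<^sup>2 - gamma1 A B k chi0 r * xi A B k chi0 x t
      - gamma_t A B k chi0 r * t - gamma0 A B k chi0 r)"
  \<comment> \<open>Each real expression has to stay under one \<open>of_real\<close>, so that its
    imaginary part is 0 at sight; the rules that distribute \<open>of_real\<close> are therefore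
    switched off.\<close>
  by (simp add: Dden_def del: of_real_diff of_real_add of_real_mult of_real_power)

text \<open>The squared modulus of \<open>z\<close> is written as \<open>z * cnj z\<close> to match
  the denominator in \<open>tendsto_quotient_at_infinity\<close>.\<close>

lemma Dden_on_Crho:
  assumes "(x, t) \<in> Crho A B k chi0 r \<alpha> \<rho>"
  defines "z \<equiv> 1 + \<i> * r * of_real (xi A B k chi0 x t)"
  shows "Dden A B k chi0 r \<alpha> x t
    = - (of_real (lambda0 A B k chi0) * (z * cnj z)) + \<i> * of_real \<rho>"
proof -
  have "Im (Dden A B k chi0 r \<alpha> x t) = \<rho>"
    using assms(1) by (simp add: Crho_def)
  moreover have "Re (Dden A B k chi0 r \<alpha> x t) = - (lambda0 A B k chi0 * (cmod z)\<^sup>2)"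
    by (simp add: Dden_def z_def del: of_real_diff of_real_add of_real_mult of_real_power)
  ultimately show ?thesis
    unfolding complex_norm_square[symmetric] by (simp add: complex_eq_iff)
qed

text \<open>For a fixed value \<open>y\<close> of \<open>xi\<close>, the curve equation is affine in
  \<open>t\<close> with slope \<open>- 2 * lambda0 * gamma_t\<close>, so it can be solved for
  \<open>t\<close>; then \<open>x\<close> is chosen to give \<open>xi\<close> the value
  \<open>y\<close>.\<close>

lemma ex_xi_eq_on_Crho:
  assumes "lambda0 A B k chi0 \<noteq> 0" "gamma_t A B k chi0 r \<noteq> 0"
  obtains x t where "(x, t) \<in> Crho A B k chi0 r \<alpha> \<rho>" "xi A B k chi0 x t = y"
proof -
  define t where "t = (zeta0 A B k chi0 r * cot \<alpha> - gamma3 chi0 r * y ^ 3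
      - gamma2 chi0 r * y\<^sup>2 - gamma1 A B k chi0 r * y - gamma0 A B k chi0 r
      - \<rho> / (2 * lambda0 A B k chi0)) / gamma_t A B k chi0 r"
  define x where "x = y - nu1 A B k chi0 * t"
  have xi: "xi A B k chi0 x t = y"
    by (simp add: xi_def x_def)
  have "gamma_t A B k chi0 r * t = zeta0 A B k chi0 r * cot \<alpha> - gamma3 chi0 r * y ^ 3
      - gamma2 chi0 r * y\<^sup>2 - gamma1 A B k chi0 r * y - gamma0 A B k chi0 r
      - \<rho> / (2 * lambda0 A B k chi0)"
    using assms(2) by (simp add: t_def)
  then have "Im (Dden A B k chi0 r \<alpha> x t) = 2 * lambda0 A B k chi0 * (\<rho> / (2 * lambda0 A B k chi0))"
    unfolding Im_Dden xi by (simp only: diff_diff_eq2) (simp add: algebra_simps)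
  then have "(x, t) \<in> Crho A B k chi0 r \<alpha> \<rho>"
    using assms(1) by (simp add: Crho_def)
  with xi show thesis
    by (rule that[rotated])
qed

text \<open>Along the filter \<open>bot\<close> every limit statement holds. Properness is what
  makes limits unique, and so rules out the limit 1 in the theorem.\<close>

lemma along_Crho_neq_bot:
  assumes "lambda0 A B k chi0 \<noteq> 0" "gamma_t A B k chi0 r \<noteq> 0"
  shows "along_Crho A B k chi0 r \<alpha> \<rho> \<noteq> bot"
proof
  assume "along_Crho A B k chi0 r \<alpha> \<rho> = bot"
  then have "eventually (\<lambda>_. False) (along_Crho A B k chi0 r \<alpha> \<rho>)"
    by simp
  then obtain N where N: "\<And>x t. N \<le> \<bar>xi A B k chi0 x t\<bar> \<Longrightarrow> (x, t) \<notin> Crho A B k chi0 r \<alpha> \<rho>"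
    unfolding along_Crho_def eventually_inf_principal eventually_filtercomap_at_top_linorder
    by auto
  \<comment> \<open>The point with \<open>xi = N\<close> contradicts the choice of \<open>N\<close>,
    whatever its sign, because \<open>N \<le> \<bar>N\<bar>\<close>.\<close>
  obtain x t where "(x, t) \<in> Crho A B k chi0 r \<alpha> \<rho>" "xi A B k chi0 x t = N"
    using ex_xi_eq_on_Crho[OF assms] by blast
  with N[of x t] show False
    using abs_ge_self[of N] by simp
qed

text \<open>The map \<open>xi\<close> is bounded linear in \<open>(x, t)\<close>, so it would send a
  bounded curve to a bounded set; yet its image of the curve is the whole real line.\<close>

lemma not_bounded_Crho:
  assumes "lambda0 A B k chi0 \<noteq> 0" "gamma_t A B k chi0 r \<noteq> 0"
  shows "\<not> bounded (Crho A B k chi0 r \<alpha> \<rho>)"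
proof
  assume "bounded (Crho A B k chi0 r \<alpha> \<rho>)"
  then have "bounded ((\<lambda>p. fst p + nu1 A B k chi0 * snd p) ` Crho A B k chi0 r \<alpha> \<rho>)"
    by (rule bounded_linear_image) (intro bounded_linear_intros)
  moreover have "(\<lambda>p. fst p + nu1 A B k chi0 * snd p) ` Crho A B k chi0 r \<alpha> \<rho> = UNIV"
  proof -
    have "y \<in> (\<lambda>p. fst p + nu1 A B k chi0 * snd p) ` Crho A B k chi0 r \<alpha> \<rho>" for y
    proof -
      obtain x t where "(x, t) \<in> Crho A B k chi0 r \<alpha> \<rho>" "xi A B k chi0 x t = y"
        using ex_xi_eq_on_Crho[OF assms] .
      then show ?thesis
        by (intro image_eqI[of _ _ "(x, t)"]) (auto simp: xi_def)
    qed
    then show ?thesis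
      by blast
  qed
  ultimately show False
    using not_bounded_UNIV[where 'a = real] by simp
qed

lemma tendsto_modulation_along_Crho:
  assumes l: "lambda0 A B k chi0 \<noteq> 0" and r: "r \<noteq> 0" and a: "a j \<noteq> 0"
  shows "((\<lambda>(x, t). uR2 A B k chi0 r a \<alpha> j x t / u0 A B k a j x t)
    \<longlongrightarrow> of_real (1 - 2 * h k j chi0)) (along_Crho A B k chi0 r \<alpha> \<rho>)"
proof -
  let ?F = "along_Crho A B k chi0 r \<alpha> \<rho>"
  define z where "z = (\<lambda>(x, t). 1 + \<i> * r * of_real (xi A B k chi0 x t))"
  have xi_lim: "filterlim (\<lambda>(x, t). \<bar>xi A B k chi0 x t\<bar>) at_top ?F"
    unfolding along_Crho_def by (rule filterlim_mono[OF filterlim_filtercomap]) auto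
  have "filterlim (\<lambda>p. complex_of_real (case_prod (xi A B k chi0) p)) at_infinity ?F"
    using xi_lim by (intro filterlim_norm_at_top_imp_at_infinity) (simp add: case_prod_unfold)
  \<comment> \<open>Here \<open>r \<noteq> 0\<close> enters: it carries the growth of
    \<open>xi\<close> over to \<open>z\<close>.\<close>
  then have "filterlim (\<lambda>p. \<i> * r * complex_of_real (case_prod (xi A B k chi0) p)) at_infinity ?F"
    using r by (intro tendsto_mult_filterlim_at_infinity[OF tendsto_const]) auto
  then have z: "filterlim z at_infinity ?F"
    unfolding z_def case_prod_unfold by (rule tendsto_add_filterlim_at_infinity[OF tendsto_const])
  let ?Q = "\<lambda>p. 2 * of_real (lambda0 A B k chi0)
      * (of_real (h k j chi0) * z p + r * of_real (hder k chi0 j 1)) * cnj (z p)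
      / (- (of_real (lambda0 A B k chi0) * (z p * cnj (z p))) + \<i> * of_real \<rho>)"
  have "(?Q \<longlongrightarrow> - 2 * of_real (h k j chi0)) ?F"
    using l by (intro tendsto_quotient_at_infinity z) simp
  then have lim: "((\<lambda>p. 1 + ?Q p) \<longlongrightarrow> 1 + - 2 * of_real (h k j chi0)) ?F"
    by (intro tendsto_intros)
  have "eventually (\<lambda>p. p \<in> Crho A B k chi0 r \<alpha> \<rho>) ?F"
    by (simp add: along_Crho_def eventually_inf_principal)
  then have "eventually (\<lambda>p. 1 + ?Q p
      = (case p of (x, t) \<Rightarrow> uR2 A B k chi0 r a \<alpha> j x t / u0 A B k a j x t)) ?F"
  proof eventually_elim
    case (elim p)
    obtain x t where p: "p = (x, t)"
      by (cases p)
    have "u0 A B k a j x t \<noteq> 0"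
      using a by (simp add: u0_def)
    then have "uR2 A B k chi0 r a \<alpha> j x t / u0 A B k a j x t
        = 1 + Nnum A B k chi0 r j x t / Dden A B k chi0 r \<alpha> x t"
      by (simp add: uR2_def)
    \<comment> \<open>The terms with \<open>hder j 0\<close> combine to
      \<open>h k j chi0 * z\<close>, which leaves the constant \<open>r * hder j 1\<close>.\<close>
    moreover have "Nnum A B k chi0 r j x t = 2 * of_real (lambda0 A B k chi0)
        * (of_real (h k j chi0) * z p + r * of_real (hder k chi0 j 1)) * cnj (z p)"
      by (simp add: Nnum_def hder_0 z_def p algebra_simps)
    moreover have "Dden A B k chi0 r \<alpha> x t
        = - (of_real (lambda0 A B k chi0) * (z p * cnj (z p))) + \<i> * of_real \<rho>"
      using Dden_on_Crho elim by (simp add: p z_def)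
    ultimately show ?case
      by (simp add: p)
  qed
  with lim show ?thesis
    using tendsto_cong by force
qed

theorem proposition40:
  fixes A B k chi0 \<alpha> :: real and r :: complex and a :: "nat \<Rightarrow> real"
  assumes "A > 0" and "B > 0" and "k \<noteq> 0"
    and "(a 1)\<^sup>2 = A" and "(a 2)\<^sup>2 = B"
    and "chi0 \<notin> {0, k, - k}"
    and "deriv (Lam A B k) chi0 = 0"
    and "(deriv ^^ 2) (Lam A B k) chi0 \<noteq> 0"
    and "r \<noteq> 0"
    and "bJ A B k chi0 * (cmod r)\<^sup>2 + 2 * aJ A B k chi0 * Re r = 0"
    and "sin \<alpha> \<noteq> 0"
    and "gamma_t A B k chi0 r \<noteq> 0"
  shows "\<forall>\<rho>::real. \<not> bounded (Crho A B k chi0 r \<alpha> \<rho>) \<and>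
    (\<forall>j\<in>{1, 2}.
      ((\<lambda>(x, t). uR2 A B k chi0 r a \<alpha> j x t / u0 A B k a j x t)
         \<longlongrightarrow> of_real (1 - 2 * h k j chi0)) (along_Crho A B k chi0 r \<alpha> \<rho>) \<and>
      \<not> ((\<lambda>(x, t). uR2 A B k chi0 r a \<alpha> j x t / u0 A B k a j x t)
         \<longlongrightarrow> 1) (along_Crho A B k chi0 r \<alpha> \<rho>))"
proof (intro allI conjI ballI)
  fix \<rho> :: real
  have l: "lambda0 A B k chi0 \<noteq> 0"
    using mu0_pos[OF assms(1-3,6,7)] by (simp add: lambda0_def)
  show "\<not> bounded (Crho A B k chi0 r \<alpha> \<rho>)"
    using not_bounded_Crho[OF l assms(12)] .
  fix j :: nat
  assume "j \<in> {1, 2}"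
  then have a: "a j \<noteq> 0"
    using assms(1,2,4,5) by auto
  show lim: "((\<lambda>(x, t). uR2 A B k chi0 r a \<alpha> j x t / u0 A B k a j x t)
    \<longlongrightarrow> of_real (1 - 2 * h k j chi0)) (along_Crho A B k chi0 r \<alpha> \<rho>)"
    using l assms(9) a by (rule tendsto_modulation_along_Crho)
  \<comment> \<open>The limit differs from 1 exactly when \<open>h k j chi0\<close> is nonzero, and
    this is a quotient of nonzero numbers.\<close>
  have "k + chi0 \<noteq> 0" "k - chi0 \<noteq> 0"
    using assms(6) by auto
  then have "h k j chi0 \<noteq> 0"
    using assms(3) by (simp add: h_def)
  then have "complex_of_real (1 - 2 * h k j chi0) \<noteq> 1"
    by simp
  then show "\<not> ((\<lambda>(x, t). uR2 A B k chi0 r a \<alpha> j x t / u0 A B k a j x t)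
    \<longlongrightarrow> 1) (along_Crho A B k chi0 r \<alpha> \<rho>)"
    using tendsto_unique[OF along_Crho_neq_bot[OF l assms(12)] lim] by blast
qed

end
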